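(* Let $a>1$ be an integer. If $n$ is an overpseudoprime to base $a$, then every divisor $d>1$ of $n$ satisfies $a^{d-1}\equiv 1\pmod d$.
   Context: For an integer $m>1$ with $\gcd(m,a)=1$, $h_a(m)$ denotes the multiplicative order of $a$ modulo $m$. The cyclotomic cosets of $a$ modulo $m$ are the orbits of $\{1,2,\ldots,m-1\}$ under $x\mapsto ax\bmod m$; $r_a(m)$ denotes their number. An odd composite number $n$ with $\gcd(n,a)=1$ is called an overpseudoprime to base $a$ if $n=r_a(n)h_a(n)+1$. *)

theory Defs
  imports "HOL-Number_Theory.Pocklington" "HOL-Combinatorics.Orbits"
begin

(* Orbits.orbit f x consists of the iterates (f ^^ k) x with k > 0.  For m > 1 and a coprime
   to m, the map x |-> a x mod m permutes the finite set {1..<m}, so each orbit contains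
   its base point and these are the usual orbits. *)

definition cyclotomic_cosets :: "nat \<Rightarrow> nat \<Rightarrow> nat set set" where
  "cyclotomic_cosets a m = Orbits.orbit (\<lambda>x. a * x mod m) ` {1..<m}"

definition num_cyclotomic_cosets :: "nat \<Rightarrow> nat \<Rightarrow> nat" where
  "num_cyclotomic_cosets a m = card (cyclotomic_cosets a m)"

(* ord n a is the multiplicative order of a modulo n: the modulus is the first argument. *)

definition overpseudoprime :: "nat \<Rightarrow> nat \<Rightarrow> bool" where
  "overpseudoprime a n \<longleftrightarrow>
     odd n \<and> n > 1 \<and> \<not> prime n \<and> coprime n a \<and>
     n = num_cyclotomic_cosets a n * ord n a + 1"

end

theory Submission
  imports Defs
begin

text \<open>
  Every orbit of \<open>x \<mapsto> a x mod n\<close> has at most \<open>h = ord n a\<close> elements, so \<open>n - 1 = r h\<close> with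
  \<open>r\<close> orbits forces every orbit to have exactly \<open>h\<close> elements. For a divisor \<open>d > 1\<close> of \<open>n\<close>, the
  \<open>d - 1\<close> multiples of \<open>n / d\<close> in \<open>{1..<n}\<close> are a union of orbits, hence \<open>h\<close> divides \<open>d - 1\<close>.
\<close>

lemma funpow_mult_mod:
  fixes a n x :: nat
  assumes "x < n"
  shows "((\<lambda>x. a * x mod n) ^^ k) x = a ^ k * x mod n"
  using assms by (induction k) (simp_all add: mod_mult_right_eq mult.assoc)

lemma funpow_ord_mult_mod:
  fixes a n x :: nat
  assumes "x < n"
  shows "((\<lambda>x. a * x mod n) ^^ ord n a) x = x"
proof -
  have "[a ^ ord n a * x = 1 * x] (mod n)"
    by (intro cong_mult ord cong_refl)
  then show ?thesis
    using assms by (simp add: funpow_mult_mod cong_def)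
qed

lemma self_in_orbit_mult_mod:
  fixes a n x :: nat
  assumes "coprime n a" "x < n"
  shows "x \<in> orbit (\<lambda>x. a * x mod n) x"
proof -
  let ?f = "\<lambda>x. a * x mod n"
  \<comment> \<open>\<open>orbit\<close> collects only iterates with positive exponent, so the
    return to \<open>x\<close> must happen at an exponent above 0; coprimality supplies
    this.\<close>
  have "x = (?f ^^ ord n a) x" "ord n a > 0"
    using assms by (simp_all add: funpow_ord_mult_mod coprime_ord)
  then show ?thesis
    unfolding orbit_altdef by blast
qed

text \<open>Iteration returns to \<open>x\<close> after \<open>ord n a\<close> steps, so the
  exponents below \<open>ord n a\<close> already list the orbit, possibly with repetitions.\<close>

lemma card_orbit_mult_mod_le:
  fixes a n x :: nat
  assumes "coprime n a" "x < n"
  shows "card (orbit (\<lambda>x. a * x mod n) x) \<le> ord n a"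
proof -
  let ?f = "\<lambda>x. a * x mod n"
  have "orbit ?f x = (\<lambda>k. (?f ^^ k) x) ` {..<ord n a}"
    using orbit_altdef_bounded[OF funpow_ord_mult_mod[OF assms(2)]] assms(1) by auto
  then show ?thesis
    using card_image_le[OF finite_lessThan, of "\<lambda>k. (?f ^^ k) x" "ord n a"] by simp
qed

text \<open>Once each point lies in its own orbit, the orbits are equivalence classes and partition
  \<open>S\<close>; the image set counts each class once.\<close>

lemma sum_card_orbits:
  assumes "finite S" and closed: "\<And>x. x \<in> S \<Longrightarrow> f x \<in> S"
    and self: "\<And>x. x \<in> S \<Longrightarrow> x \<in> orbit f x"
  shows "(\<Sum>C\<in>orbit f ` S. card C) = card S"
proof -
  have sub: "orbit f x \<subseteq> S" if "x \<in> S" for x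
  proof
    fix y assume "y \<in> orbit f x"
    then show "y \<in> S"
      by induction (use that closed in auto)
  qed
  \<comment> \<open>Since \<open>x\<close> returns to itself, it is also reachable from
    \<open>z\<close>; transitivity then gives both inclusions.\<close>
  have eq_rep: "orbit f z = orbit f x" if "x \<in> S" "z \<in> orbit f x" for x z
    using orbit_swap[OF self[OF that(1)] that(2)] that(2) by (blast intro: orbit_trans)
  have eq: "orbit f x = orbit f y"
    if "x \<in> S" "y \<in> S" "z \<in> orbit f x" "z \<in> orbit f y" for x y z
    using eq_rep[OF that(1,3)] eq_rep[OF that(2,4)] by simp
  have "\<Union> (orbit f ` S) = S"
    using sub self by blast
  moreover have "card (\<Union> (orbit f ` S)) = (\<Sum>C\<in>orbit f ` S. card C)"
  proof (rule card_Union_disjoint)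
    show "pairwise disjnt (orbit f ` S)"
      unfolding pairwise_def disjnt_def using eq by blast
    show "finite C" if "C \<in> orbit f ` S" for C
      using that sub assms(1) finite_subset by blast
  qed
  ultimately show ?thesis by simp
qed

text \<open>By coprimality \<open>n\<close> could divide \<open>a * x\<close> only by dividing
  \<open>x\<close>, and reduction modulo \<open>n\<close> respects divisibility by a divisor of
  \<open>n\<close>. The case \<open>q = 1\<close> covers all of \<open>{1..<n}\<close>.\<close>

lemma mult_mod_closed:
  fixes a n q x :: nat
  assumes "coprime n a" "q dvd n" "x \<in> {1..<n}" "q dvd x"
  shows "a * x mod n \<in> {1..<n}" "q dvd a * x mod n"
proof -
  have "\<not> n dvd a * x"
    using assms(1,3) by (auto simp: coprime_dvd_mult_right_iff dest: dvd_imp_le)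
  then show "a * x mod n \<in> {1..<n}"
    using assms(3) by (auto simp: dvd_eq_mod_eq_0)
  show "q dvd a * x mod n"
    using assms(2,4) by (simp add: dvd_mod_iff)
qed

lemma card_orbit_overpseudoprime:
  assumes "overpseudoprime a n" "x \<in> {1..<n}"
  shows "card (orbit (\<lambda>x. a * x mod n) x) = ord n a"
proof -
  let ?f = "\<lambda>x. a * x mod n" and ?S = "{1..<n}"
  have cop: "coprime n a" and n: "n = card (orbit ?f ` ?S) * ord n a + 1"
    using assms(1)
    unfolding overpseudoprime_def num_cyclotomic_cosets_def cyclotomic_cosets_def by blast+
  have "(\<Sum>C\<in>orbit ?f ` ?S. card C) = card ?S"
    using mult_mod_closed(1)[OF cop, of 1] self_in_orbit_mult_mod[OF cop]
    by (intro sum_card_orbits) auto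
  also have "\<dots> = (\<Sum>C\<in>orbit ?f ` ?S. ord n a)"
    using arg_cong[OF n, of "\<lambda>k. k - 1"]
    by (simp only: card_atLeastLessThan sum_constant add_diff_cancel_right' of_nat_id)
  finally show ?thesis
    using assms(2) card_orbit_mult_mod_le[OF cop]
    \<comment> \<open>Termwise bounded sums with equal totals agree in every term.\<close>
    by (intro sum_mono_inv[where I = "orbit ?f ` ?S" and f = card and g = "\<lambda>_. ord n a"]) auto
qed

lemma ord_dvd_divisor_minus_one:
  assumes over: "overpseudoprime a n" and "d dvd n"
  shows "ord n a dvd d - 1"
proof -
  have cop: "coprime n a" and "n > 1"
    using over unfolding overpseudoprime_def by blast+
  obtain q where n: "n = d * q"
    using \<open>d dvd n\<close> by blast
  let ?f = "\<lambda>x. a * x mod n"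
  define S where "S = {x \<in> {1..<n}. q dvd x}"
  have "q > 0"
    using \<open>n > 1\<close> n by (cases q) auto
  have "S = (*) q ` {1..<d}"
  proof (intro equalityI subsetI)
    fix x assume "x \<in> S"
    then obtain k where "x = q * k" "0 < q * k" "q * k < q * d"
      by (auto simp: S_def n mult.commute)
    then show "x \<in> (*) q ` {1..<d}"
      by auto
  next
    fix x assume "x \<in> (*) q ` {1..<d}"
    then show "x \<in> S"
      using \<open>q > 0\<close> by (auto simp: S_def n mult.commute)
  qed
  then have "card S = d - 1"
    using \<open>q > 0\<close> by (simp add: card_image inj_on_def)
  moreover have "(\<Sum>C\<in>orbit ?f ` S. card C) = card S"
  proof (rule sum_card_orbits)
    show "?f x \<in> S" if "x \<in> S" for x
      using that mult_mod_closed[OF cop, of q x] n by (auto simp: S_def)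
  qed (use self_in_orbit_mult_mod[OF cop] in \<open>auto simp: S_def\<close>)
  \<comment> \<open>Points of \<open>S\<close> lie in \<open>{1..<n}\<close>, so their orbits have
    the full size \<open>ord n a\<close>.\<close>
  moreover have "(\<Sum>C\<in>orbit ?f ` S. card C) = (\<Sum>C\<in>orbit ?f ` S. ord n a)"
    using card_orbit_overpseudoprime[OF over] by (intro sum.cong) (auto simp: S_def)
  ultimately have "d - 1 = card (orbit ?f ` S) * ord n a"
    by simp
  then show ?thesis
    by (rule dvdI[OF trans[OF _ mult.commute]])
qed

theorem theorem13:
  fixes a n :: nat
  assumes "a > 1"
    and "overpseudoprime a n"
  shows "\<forall>d. d dvd n \<and> d > 1 \<longrightarrow> [a ^ (d - 1) = 1] (mod d)"
proof (intro allI impI)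
  fix d assume d: "d dvd n \<and> d > 1"
  then have "ord n a dvd d - 1"
    using ord_dvd_divisor_minus_one[OF assms(2)] by blast
  \<comment> \<open>The order is taken modulo \<open>n\<close>, so the congruence holds even modulo
    \<open>n\<close> and then descends to \<open>d\<close>.\<close>
  then have "[a ^ (d - 1) = 1] (mod n)"
    by (simp only: ord_divides)
  then show "[a ^ (d - 1) = 1] (mod d)"
    using conjunct1[OF d] by (rule cong_dvd_modulus_nat)
qed

end
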